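(* Let $F$ be a field, $L$ a separable field extension of $F$, $\sigma\in\mathrm{Aut}(L/F)$ a nontrivial automorphism, and $\eta,\mu\in L$ with $\eta\neq0$ and $\mu\neq0$. Let $G=\mathrm{Aut}(L/F)$ and let $C_G(\sigma)$ be the centraliser of $\sigma$ in $G$. If $A$ is one of the algebras $HK(L,\sigma,\eta,\mu)$, $Kn_2(L,\sigma,\eta,\mu)$ or $Kn_3(L,\sigma,\eta,\mu)$, then the automorphism group of $A$ is isomorphic to the subgroup of $C_G(\sigma)$ which fixes the element $\mu\sigma(\mu)\sigma(\eta)^{-1}$, i.e. $$\mathrm{Aut}(A)\cong\left\{\tau\in C_G(\sigma)\ \middle|\ \tau\left(\frac{\mu\sigma(\mu)}{\sigma(\eta)}\right)=\frac{\mu\sigma(\mu)}{\sigma(\eta)}\right\}.$$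
   Context: The algebras are the $F$-vector space $L\oplus L$ with the respective multiplications (for $x,y,u,v\in L$): $Kn_2$: $(x,y)(u,v)=(xu+\eta\sigma^{-1}(v)\sigma^{-2}(y),\ vx+y\sigma(u)+\mu v\sigma^{-1}(y))$; $Kn_3$: $(x,y)(u,v)=(xu+\eta\sigma^{-1}(v)y,\ vx+y\sigma(u)+\mu vy)$; $HK$: $(x,y)(u,v)=(xu+\eta\sigma(v)y,\ vx+y\sigma(u)+\mu\sigma(v)y)$. $\mathrm{Aut}(A)$ denotes the group of $F$-algebra automorphisms of $A$. *)

theory Defs
  imports "HOL-Algebra.Algebraic_Closure" "HOL-Algebra.Bij"
begin

section \<open>Field extensions\<close>

text \<open>An algebraic element whose minimal polynomial over \<open>K\<close> has only simple roots in an
  algebraic closure of \<open>L\<close>; the map \<open>indexed_const\<close> embeds \<open>L\<close> into \<open>alg_closure L\<close>.\<close>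

definition separable_element :: "'a set \<Rightarrow> ('a, 'm) ring_scheme \<Rightarrow> 'a \<Rightarrow> bool" where
  "separable_element K L x \<longleftrightarrow>
     ring.algebraic L K x \<and>
     (\<forall>a \<in> carrier (field.alg_closure L).
        ring.alg_mult (field.alg_closure L) (map (ring.indexed_const L) (ring.Irr L K x)) a \<le> 1)"

definition separable_extension :: "'a set \<Rightarrow> ('a, 'm) ring_scheme \<Rightarrow> bool" where
  "separable_extension F L \<longleftrightarrow>
     field L \<and> subfield F L \<and> (\<forall>x \<in> carrier L. separable_element F L x)"

definition field_Aut :: "('a, 'm) ring_scheme \<Rightarrow> 'a set \<Rightarrow> ('a \<Rightarrow> 'a) monoid" where
  "field_Aut L F = BijGroup (carrier L)
     \<lparr>carrier := {f \<in> Bij (carrier L) \<inter> ring_hom L L. \<forall>a \<in> F. f a = a}\<rparr>"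

definition centraliser :: "('g, 'n) monoid_scheme \<Rightarrow> 'g \<Rightarrow> 'g set" where
  "centraliser G s = {t \<in> carrier G. t \<otimes>\<^bsub>G\<^esub> s = s \<otimes>\<^bsub>G\<^esub> t}"

section \<open>Nonassociative algebras on \<open>L \<oplus> L\<close>\<close>

text \<open>A unital nonassociative \<open>F\<close>-algebra is represented by a record of type \<open>module\<close>,
  which carries both a multiplication and a scalar multiplication. Records assert no axioms,
  so associativity is not implied. The scalar multiplication below is defined for scalars
  in \<open>L\<close>, but only scalars in \<open>F\<close> are relevant for automorphisms.\<close>

definition alg_Aut :: "'a set \<Rightarrow> ('a, 'b, 'm) module_scheme \<Rightarrow> ('b \<Rightarrow> 'b) monoid" where
  "alg_Aut F A = BijGroup (carrier A)
     \<lparr>carrier := {f \<in> Bij (carrier A) \<inter> ring_hom A A.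
        \<forall>a \<in> F. \<forall>x \<in> carrier A. f (a \<odot>\<^bsub>A\<^esub> x) = a \<odot>\<^bsub>A\<^esub> f x}\<rparr>"

definition double_algebra ::
  "('a, 'm) ring_scheme \<Rightarrow> ('a \<times> 'a \<Rightarrow> 'a \<times> 'a \<Rightarrow> 'a \<times> 'a) \<Rightarrow> ('a, 'a \<times> 'a) module" where
  "double_algebra L m =
     \<lparr>carrier = carrier L \<times> carrier L,
      monoid.mult = m,
      monoid.one = (\<one>\<^bsub>L\<^esub>, \<zero>\<^bsub>L\<^esub>),
      ring.zero = (\<zero>\<^bsub>L\<^esub>, \<zero>\<^bsub>L\<^esub>),
      ring.add = (\<lambda>(x, y) (u, v). (x \<oplus>\<^bsub>L\<^esub> u, y \<oplus>\<^bsub>L\<^esub> v)),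
      module.smult = (\<lambda>a (x, y). (a \<otimes>\<^bsub>L\<^esub> x, a \<otimes>\<^bsub>L\<^esub> y))\<rparr>"

definition HK ::
  "('a, 'm) ring_scheme \<Rightarrow> ('a \<Rightarrow> 'a) \<Rightarrow> 'a \<Rightarrow> 'a \<Rightarrow> ('a, 'a \<times> 'a) module" where
  "HK L \<sigma> \<eta> \<mu> = double_algebra L (\<lambda>(x, y) (u, v).
     (x \<otimes>\<^bsub>L\<^esub> u \<oplus>\<^bsub>L\<^esub> \<eta> \<otimes>\<^bsub>L\<^esub> \<sigma> v \<otimes>\<^bsub>L\<^esub> y,
      v \<otimes>\<^bsub>L\<^esub> x \<oplus>\<^bsub>L\<^esub> y \<otimes>\<^bsub>L\<^esub> \<sigma> u \<oplus>\<^bsub>L\<^esub> \<mu> \<otimes>\<^bsub>L\<^esub> \<sigma> v \<otimes>\<^bsub>L\<^esub> y))"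

definition Kn2 ::
  "('a, 'm) ring_scheme \<Rightarrow> ('a \<Rightarrow> 'a) \<Rightarrow> 'a \<Rightarrow> 'a \<Rightarrow> ('a, 'a \<times> 'a) module" where
  "Kn2 L \<sigma> \<eta> \<mu> = (let \<sigma>' = inv_into (carrier L) \<sigma> in double_algebra L (\<lambda>(x, y) (u, v).
     (x \<otimes>\<^bsub>L\<^esub> u \<oplus>\<^bsub>L\<^esub> \<eta> \<otimes>\<^bsub>L\<^esub> \<sigma>' v \<otimes>\<^bsub>L\<^esub> \<sigma>' (\<sigma>' y),
      v \<otimes>\<^bsub>L\<^esub> x \<oplus>\<^bsub>L\<^esub> y \<otimes>\<^bsub>L\<^esub> \<sigma> u \<oplus>\<^bsub>L\<^esub> \<mu> \<otimes>\<^bsub>L\<^esub> v \<otimes>\<^bsub>L\<^esub> \<sigma>' y)))"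

definition Kn3 ::
  "('a, 'm) ring_scheme \<Rightarrow> ('a \<Rightarrow> 'a) \<Rightarrow> 'a \<Rightarrow> 'a \<Rightarrow> ('a, 'a \<times> 'a) module" where
  "Kn3 L \<sigma> \<eta> \<mu> = (let \<sigma>' = inv_into (carrier L) \<sigma> in double_algebra L (\<lambda>(x, y) (u, v).
     (x \<otimes>\<^bsub>L\<^esub> u \<oplus>\<^bsub>L\<^esub> \<eta> \<otimes>\<^bsub>L\<^esub> \<sigma>' v \<otimes>\<^bsub>L\<^esub> y,
      v \<otimes>\<^bsub>L\<^esub> x \<oplus>\<^bsub>L\<^esub> y \<otimes>\<^bsub>L\<^esub> \<sigma> u \<oplus>\<^bsub>L\<^esub> \<mu> \<otimes>\<^bsub>L\<^esub> v \<otimes>\<^bsub>L\<^esub> y)))"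

end

theory Submission
  imports Defs
begin

text \<open>All three algebras have the shape
  \<open>(x, y)(u, v) = (xu + \<eta> \<alpha>(v) \<beta>(y), vx + y \<sigma>(u) + \<mu> \<gamma>(v) \<delta>(y))\<close>, where \<open>\<alpha>\<close>, \<open>\<beta>\<close>, \<open>\<gamma>\<close>, \<open>\<delta>\<close> are
  powers of \<open>\<sigma>\<close>. Since \<open>\<mu> \<noteq> 0\<close> and \<open>\<sigma>\<close> is nontrivial, the summand \<open>L \<oplus> 0\<close> is exactly the right
  nucleus (\<open>Kn\<^sub>2\<close>, \<open>Kn\<^sub>3\<close>) or the left nucleus (\<open>HK\<close>), so every automorphism \<open>g\<close> restricts to
  some \<open>\<tau> \<in> Aut(L/F)\<close> on it. From \<open>(0, 1)(u, 0) = (0, \<sigma>(u))\<close> one gets \<open>g(0, 1) = (0, b)\<close> with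
  \<open>b \<noteq> 0\<close>, and that \<open>\<tau>\<close> commutes with \<open>\<sigma>\<close>; thus \<open>g(x, y) = (\<tau>(x), b \<tau>(y))\<close>. Squaring \<open>(0, 1)\<close> gives
  \<open>\<tau>(\<mu>) = \<mu> \<gamma>\<delta>(b)\<close>, which determines \<open>b\<close> from \<open>\<tau>\<close>, and \<open>\<tau>(\<eta>) = \<eta> \<alpha>(b) \<beta>(b)\<close>, which is then
  equivalent to \<open>\<tau>\<close> fixing \<open>\<mu> \<sigma>(\<mu>) \<sigma>(\<eta>)\<inverse>\<close>.\<close>

section \<open>Automorphism groups of the field and of the algebra\<close>

lemma field_Aut_iff:
  "\<tau> \<in> carrier (field_Aut L F) \<longleftrightarrow>
    \<tau> \<in> extensional (carrier L) \<and> bij_betw \<tau> (carrier L) (carrier L) \<and> \<tau> \<in> ring_hom L L \<and>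
    (\<forall>a\<in>F. \<tau> a = a)"
  by (auto simp: field_Aut_def Bij_def)

lemma field_Aut_mult:
  "\<tau> \<in> carrier (field_Aut L F) \<Longrightarrow> \<rho> \<in> carrier (field_Aut L F) \<Longrightarrow>
    \<tau> \<otimes>\<^bsub>field_Aut L F\<^esub> \<rho> = compose (carrier L) \<tau> \<rho>"
  by (simp add: field_Aut_def BijGroup_def)

lemma alg_Aut_iff:
  "g \<in> carrier (alg_Aut F A) \<longleftrightarrow>
    g \<in> extensional (carrier A) \<and> bij_betw g (carrier A) (carrier A) \<and> g \<in> ring_hom A A \<and>
    (\<forall>a\<in>F. \<forall>x\<in>carrier A. g (a \<odot>\<^bsub>A\<^esub> x) = a \<odot>\<^bsub>A\<^esub> g x)"
  by (auto simp: alg_Aut_def Bij_def)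

lemma alg_Aut_mult:
  "g \<in> carrier (alg_Aut F A) \<Longrightarrow> h \<in> carrier (alg_Aut F A) \<Longrightarrow>
    g \<otimes>\<^bsub>alg_Aut F A\<^esub> h = compose (carrier A) g h"
  by (simp add: alg_Aut_def BijGroup_def)

lemma field_Aut_centraliser_iff:
  assumes "\<sigma> \<in> carrier (field_Aut L F)"
  shows "\<tau> \<in> centraliser (field_Aut L F) \<sigma> \<longleftrightarrow>
    \<tau> \<in> carrier (field_Aut L F) \<and> (\<forall>x\<in>carrier L. \<tau> (\<sigma> x) = \<sigma> (\<tau> x))"
proof (cases "\<tau> \<in> carrier (field_Aut L F)")
  case True
  have "compose (carrier L) \<tau> \<sigma> = compose (carrier L) \<sigma> \<tau> \<longleftrightarrow>
      (\<forall>x\<in>carrier L. \<tau> (\<sigma> x) = \<sigma> (\<tau> x))"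
    by (auto simp: compose_def restrict_def fun_eq_iff)
  then show ?thesis
    using True assms by (simp add: centraliser_def field_Aut_mult)
qed (simp add: centraliser_def)

section \<open>Nuclei and their invariance under automorphisms\<close>

definition right_nucleus :: "('a, 'm) monoid_scheme \<Rightarrow> 'a set" where
  "right_nucleus A = {z \<in> carrier A. \<forall>x\<in>carrier A. \<forall>y\<in>carrier A.
     (x \<otimes>\<^bsub>A\<^esub> y) \<otimes>\<^bsub>A\<^esub> z = x \<otimes>\<^bsub>A\<^esub> (y \<otimes>\<^bsub>A\<^esub> z)}"

definition left_nucleus :: "('a, 'm) monoid_scheme \<Rightarrow> 'a set" where
  "left_nucleus A = {z \<in> carrier A. \<forall>x\<in>carrier A. \<forall>y\<in>carrier A.
     (z \<otimes>\<^bsub>A\<^esub> x) \<otimes>\<^bsub>A\<^esub> y = z \<otimes>\<^bsub>A\<^esub> (x \<otimes>\<^bsub>A\<^esub> y)}"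

text \<open>A triple associates iff its image under g does, because g is multiplicative and
  injective; surjectivity lets the quantifiers in the nuclei run over images only. Records carry no
  axioms, so closure of the product is assumed.\<close>

lemma
  assumes g: "g \<in> carrier (alg_Aut F A)"
    and closed: "\<And>x y. x \<in> carrier A \<Longrightarrow> y \<in> carrier A \<Longrightarrow> x \<otimes>\<^bsub>A\<^esub> y \<in> carrier A"
  shows alg_Aut_right_nucleus: "g ` right_nucleus A = right_nucleus A"
    and alg_Aut_left_nucleus: "g ` left_nucleus A = left_nucleus A"
proof -
  have surj: "g ` carrier A = carrier A" and inj: "inj_on g (carrier A)"
    and hom: "\<And>x y. x \<in> carrier A \<Longrightarrow> y \<in> carrier A \<Longrightarrow> g (x \<otimes>\<^bsub>A\<^esub> y) = g x \<otimes>\<^bsub>A\<^esub> g y"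
    using g by (auto simp: alg_Aut_iff bij_betw_def ring_hom_def)
  have mem: "g x \<in> carrier A" if "x \<in> carrier A" for x
    using surj that by blast
  have assoc: "(g x \<otimes>\<^bsub>A\<^esub> g y) \<otimes>\<^bsub>A\<^esub> g z = g x \<otimes>\<^bsub>A\<^esub> (g y \<otimes>\<^bsub>A\<^esub> g z) \<longleftrightarrow>
      (x \<otimes>\<^bsub>A\<^esub> y) \<otimes>\<^bsub>A\<^esub> z = x \<otimes>\<^bsub>A\<^esub> (y \<otimes>\<^bsub>A\<^esub> z)"
    if "x \<in> carrier A" "y \<in> carrier A" "z \<in> carrier A" for x y z
    using that inj by (simp add: hom[symmetric] closed inj_on_eq_iff)
  have all: "(\<forall>x\<in>carrier A. P x) \<longleftrightarrow> (\<forall>x\<in>carrier A. P (g x))" for P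
    using surj by (metis (no_types, lifting) image_iff)
  have "g z \<in> right_nucleus A \<longleftrightarrow> z \<in> right_nucleus A"
    and "g z \<in> left_nucleus A \<longleftrightarrow> z \<in> left_nucleus A" if "z \<in> carrier A" for z
    unfolding right_nucleus_def left_nucleus_def mem_Collect_eq
    by (subst (1 2) all, simp add: that mem assoc)+
  moreover have "right_nucleus A \<subseteq> carrier A" "left_nucleus A \<subseteq> carrier A"
    by (auto simp: right_nucleus_def left_nucleus_def)
  moreover have "g ` N = N"
    if sub: "N \<subseteq> carrier A" and iff: "\<And>z. z \<in> carrier A \<Longrightarrow> g z \<in> N \<longleftrightarrow> z \<in> N" for N
  proof (intro equalityI subsetI)
    fix w assume "w \<in> N"
    then obtain z where "z \<in> carrier A" "w = g z"
      using sub surj by blast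
    then show "w \<in> g ` N"
      using iff \<open>w \<in> N\<close> by blast
  qed (use sub iff in auto)
  ultimately show "g ` right_nucleus A = right_nucleus A" "g ` left_nucleus A = left_nucleus A"
    by metis+
qed

section \<open>Maps that behave like powers of \<sigma>\<close>

text \<open>Stands in for the powers of \<open>\<sigma>\<close>: all that is needed of them is that they are automorphisms
  and commute with whatever commutes with \<open>\<sigma>\<close>.\<close>

definition twists :: "('a, 'm) ring_scheme \<Rightarrow> ('a \<Rightarrow> 'a) \<Rightarrow> ('a \<Rightarrow> 'a) set" where
  "twists L \<sigma> = {\<phi> \<in> ring_hom L L. \<phi> ` carrier L = carrier L \<and>
     (\<forall>\<tau>\<in>ring_hom L L. (\<forall>x\<in>carrier L. \<tau> (\<sigma> x) = \<sigma> (\<tau> x)) \<longrightarrow>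
        (\<forall>x\<in>carrier L. \<tau> (\<phi> x) = \<phi> (\<tau> x)))}"

lemma twistsD:
  assumes "\<phi> \<in> twists L \<sigma>"
  shows "\<phi> \<in> ring_hom L L" "\<phi> ` carrier L = carrier L"
    "\<tau> \<in> ring_hom L L \<Longrightarrow> (\<And>x. x \<in> carrier L \<Longrightarrow> \<tau> (\<sigma> x) = \<sigma> (\<tau> x)) \<Longrightarrow>
      x \<in> carrier L \<Longrightarrow> \<tau> (\<phi> x) = \<phi> (\<tau> x)"
  using assms by (auto simp: twists_def)

lemma twists_id: "(\<lambda>x. x) \<in> twists L \<sigma>"
  by (auto simp: twists_def ring_hom_def)

lemma twists_comp:
  assumes \<phi>: "\<phi> \<in> twists L \<sigma>" and \<psi>: "\<psi> \<in> twists L \<sigma>"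
  shows "(\<lambda>x. \<phi> (\<psi> x)) \<in> twists L \<sigma>"
proof -
  have "(\<lambda>x. \<phi> (\<psi> x)) \<in> ring_hom L L"
    using ring_hom_trans[OF twistsD(1)[OF \<psi>] twistsD(1)[OF \<phi>]] by (simp add: comp_def)
  moreover have "(\<lambda>x. \<phi> (\<psi> x)) ` carrier L = carrier L"
    by (metis image_image twistsD(2)[OF \<phi>] twistsD(2)[OF \<psi>])
  moreover have "\<tau> (\<phi> (\<psi> x)) = \<phi> (\<psi> (\<tau> x))"
    if "\<tau> \<in> ring_hom L L" "\<And>x. x \<in> carrier L \<Longrightarrow> \<tau> (\<sigma> x) = \<sigma> (\<tau> x)" "x \<in> carrier L" for \<tau> x
    using twistsD(3)[OF \<phi> that(1,2)] twistsD(3)[OF \<psi> that] twistsD(1)[OF \<psi>] that(3)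
    by (simp add: ring_hom_closed)
  ultimately show ?thesis
    unfolding twists_def by blast
qed

lemma twists_self:
  "\<sigma> \<in> ring_hom L L \<Longrightarrow> \<sigma> ` carrier L = carrier L \<Longrightarrow> \<sigma> \<in> twists L \<sigma>"
  by (simp add: twists_def)

lemma twists_inv:
  assumes "ring L" and hom: "\<sigma> \<in> ring_hom L L" and bij: "bij_betw \<sigma> (carrier L) (carrier L)"
  shows "inv_into (carrier L) \<sigma> \<in> twists L \<sigma>"
proof -
  let ?\<sigma>' = "inv_into (carrier L) \<sigma>"
  have "\<sigma> \<in> ring_iso L L"
    using hom bij by (simp add: ring_iso_def)
  then have "?\<sigma>' \<in> ring_iso L L"
    by (rule ring_iso_set_sym[OF \<open>ring L\<close>])
  then have hom': "?\<sigma>' \<in> ring_hom L L" and im: "?\<sigma>' ` carrier L = carrier L"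
    by (auto simp: ring_iso_def bij_betw_def)
  have "\<tau> (?\<sigma>' x) = ?\<sigma>' (\<tau> x)"
    if \<tau>: "\<tau> \<in> ring_hom L L" "\<And>x. x \<in> carrier L \<Longrightarrow> \<tau> (\<sigma> x) = \<sigma> (\<tau> x)"
      and x: "x \<in> carrier L" for \<tau> x
  proof -
    have "\<tau> (?\<sigma>' x) = ?\<sigma>' (\<sigma> (\<tau> (?\<sigma>' x)))"
      using x \<tau>(1) hom' bij by (simp add: bij_betw_inv_into_left ring_hom_closed)
    also have "\<sigma> (\<tau> (?\<sigma>' x)) = \<tau> (\<sigma> (?\<sigma>' x))"
      using x \<tau>(2) hom' by (simp add: ring_hom_closed)
    also have "\<sigma> (?\<sigma>' x) = x"
      using x bij by (simp add: bij_betw_inv_into_right)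
    finally show ?thesis .
  qed
  with hom' im show ?thesis
    by (auto simp: twists_def)
qed

section \<open>The common shape of the three algebras\<close>

text \<open>The disjuncts of \<open>nuclear\<close> are the cases in which L \<oplus> 0 is the right
  or the left nucleus. \<open>norm\<close> links the factors by which an automorphism multiplies
  \<eta> and \<mu>; it is what makes \<mu> \<sigma>(\<mu>) / \<sigma>(\<eta>) invariant.\<close>

locale twisted_double = field L for L (structure) +
  fixes F :: "'a set" and \<sigma> \<alpha> \<beta> \<gamma> \<delta> :: "'a \<Rightarrow> 'a" and \<eta> \<mu> :: 'a
  assumes F_subset: "F \<subseteq> carrier L"
    and twists: "\<sigma> \<in> twists L \<sigma>" "\<alpha> \<in> twists L \<sigma>" "\<beta> \<in> twists L \<sigma>" "\<gamma> \<in> twists L \<sigma>" "\<delta> \<in> twists L \<sigma>"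
    and \<sigma>_Aut: "\<sigma> \<in> carrier (field_Aut L F)"
    and nontrivial: "\<exists>x\<in>carrier L. \<sigma> x \<noteq> x"
    and \<eta>: "\<eta> \<in> carrier L" "\<eta> \<noteq> \<zero>" and \<mu>: "\<mu> \<in> carrier L" "\<mu> \<noteq> \<zero>"
    and norm: "\<And>b. b \<in> carrier L \<Longrightarrow> \<sigma> (\<alpha> b \<otimes> \<beta> b) = \<gamma> (\<delta> b) \<otimes> \<sigma> (\<gamma> (\<delta> b))"
    and nuclear: "(\<forall>b\<in>carrier L. \<alpha> (\<sigma> b) = b \<and> \<gamma> b = b) \<or> (\<forall>b\<in>carrier L. \<beta> b = b \<and> \<delta> b = b)"
begin

definition alg :: "('a, 'a \<times> 'a) module" where
  "alg = double_algebra L (\<lambda>(x, y) (u, v).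
     (x \<otimes> u \<oplus> \<eta> \<otimes> \<alpha> v \<otimes> \<beta> y, v \<otimes> x \<oplus> y \<otimes> \<sigma> u \<oplus> \<mu> \<otimes> \<gamma> v \<otimes> \<delta> y))"

lemma alg_simps [simp]:
  "carrier alg = carrier L \<times> carrier L"
  "(x, y) \<otimes>\<^bsub>alg\<^esub> (u, v) =
     (x \<otimes> u \<oplus> \<eta> \<otimes> \<alpha> v \<otimes> \<beta> y, v \<otimes> x \<oplus> y \<otimes> \<sigma> u \<oplus> \<mu> \<otimes> \<gamma> v \<otimes> \<delta> y)"
  "(x, y) \<oplus>\<^bsub>alg\<^esub> (u, v) = (x \<oplus> u, y \<oplus> v)"
  "\<one>\<^bsub>alg\<^esub> = (\<one>, \<zero>)"
  "a \<odot>\<^bsub>alg\<^esub> (x, y) = (a \<otimes> x, a \<otimes> y)"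
  by (simp_all add: alg_def double_algebra_def)

lemma hom_inj_iff:
  "\<phi> \<in> ring_hom L L \<Longrightarrow> x \<in> carrier L \<Longrightarrow> y \<in> carrier L \<Longrightarrow> \<phi> x = \<phi> y \<longleftrightarrow> x = y"
  using non_trivial_field_hom_is_inj[OF _ field_axioms field_axioms] by (metis inj_on_def)

lemmas twists_hom = twists[THEN twistsD(1)]

lemmas twists_simps [simp] =
  twists_hom[THEN ring_hom_closed] twists_hom[THEN ring_hom_mult] twists_hom[THEN ring_hom_add]
  twists_hom[THEN ring_hom_one] twists_hom[THEN ring_hom_zero, OF ring_axioms ring_axioms]
  twists_hom[THEN hom_inj_iff]

lemma twists_zero_iff [simp]:
  "x \<in> carrier L \<Longrightarrow> \<sigma> x = \<zero> \<longleftrightarrow> x = \<zero>" "x \<in> carrier L \<Longrightarrow> \<alpha> x = \<zero> \<longleftrightarrow> x = \<zero>"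
  "x \<in> carrier L \<Longrightarrow> \<beta> x = \<zero> \<longleftrightarrow> x = \<zero>" "x \<in> carrier L \<Longrightarrow> \<gamma> x = \<zero> \<longleftrightarrow> x = \<zero>"
  "x \<in> carrier L \<Longrightarrow> \<delta> x = \<zero> \<longleftrightarrow> x = \<zero>"
  by (metis twists_hom hom_inj_iff ring_hom_zero ring_axioms zero_closed)+

lemma alg_closed: "p \<in> carrier alg \<Longrightarrow> q \<in> carrier alg \<Longrightarrow> p \<otimes>\<^bsub>alg\<^esub> q \<in> carrier alg"
  using \<eta> \<mu> by (cases p, cases q) auto

section \<open>The first summand as a nucleus\<close>

lemma distinct_multiples:
  assumes "a \<in> carrier L" "b \<in> carrier L" "c \<in> carrier L" "d \<in> carrier L"
    and "d \<oplus> a \<otimes> b = d \<oplus> a \<otimes> c" "b \<noteq> c"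
  shows "a = \<zero>"
  using assms by (metis add.l_cancel m_closed m_lcancel)

text \<open>Associating (x, 0), (0, 1), in either order, with (a, b) and comparing second components
  gives \<mu> b (\<delta>(x) - x) = 0 and \<mu> b (\<delta>(\<sigma>(x)) - x) = 0. If \<sigma> moves
  x, injectivity of \<delta> makes one of the differences nonzero, so b = 0.\<close>

lemma right_nucleus_alg:
  assumes "\<And>b. b \<in> carrier L \<Longrightarrow> \<alpha> (\<sigma> b) = b" and "\<And>b. b \<in> carrier L \<Longrightarrow> \<gamma> b = b"
  shows "right_nucleus alg = carrier L \<times> {\<zero>}"
proof (intro equalityI subrelI)
  fix a b
  assume ab: "(a, b) \<in> right_nucleus alg"
  then have [simp]: "a \<in> carrier L" "b \<in> carrier L"
    by (auto simp: right_nucleus_def)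
  have assoc: "(p \<otimes>\<^bsub>alg\<^esub> q) \<otimes>\<^bsub>alg\<^esub> (a, b) = p \<otimes>\<^bsub>alg\<^esub> (q \<otimes>\<^bsub>alg\<^esub> (a, b))"
    if "p \<in> carrier alg" "q \<in> carrier alg" for p q
    using ab that unfolding right_nucleus_def by blast
  obtain x where x [simp]: "x \<in> carrier L" and "\<sigma> x \<noteq> x"
    using nontrivial by blast
  then have "\<delta> x \<noteq> x \<or> \<delta> (\<sigma> x) \<noteq> x"
    by (metis twists_hom(1) twists_hom(5) hom_inj_iff ring_hom_closed)
  then have "\<mu> \<otimes> b = \<zero>"
  proof
    have "x \<otimes> \<sigma> a \<oplus> (\<mu> \<otimes> b) \<otimes> \<delta> x = x \<otimes> \<sigma> a \<oplus> (\<mu> \<otimes> b) \<otimes> x"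
      using assoc[of "(x, \<zero>)" "(\<zero>, \<one>)"] \<eta> \<mu> by (simp add: assms r_distr l_distr m_comm)
    moreover assume "\<delta> x \<noteq> x"
    ultimately show ?thesis
      using distinct_multiples[of "\<mu> \<otimes> b" "\<delta> x" x "x \<otimes> \<sigma> a"] \<mu> by simp
  next
    have "\<sigma> x \<otimes> \<sigma> a \<oplus> (\<mu> \<otimes> b) \<otimes> \<delta> (\<sigma> x) = \<sigma> x \<otimes> \<sigma> a \<oplus> (\<mu> \<otimes> b) \<otimes> x"
      using assoc[of "(\<zero>, \<one>)" "(x, \<zero>)"] \<eta> \<mu> by (simp add: assms m_assoc)
    moreover assume "\<delta> (\<sigma> x) \<noteq> x"
    ultimately show ?thesis
      using distinct_multiples[of "\<mu> \<otimes> b" "\<delta> (\<sigma> x)" x "\<sigma> x \<otimes> \<sigma> a"] \<mu> by simp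
  qed
  then show "(a, b) \<in> carrier L \<times> {\<zero>}"
    using \<mu> by (simp add: integral_iff)
next
  fix a b
  assume "(a, b) \<in> carrier L \<times> {\<zero>}"
  then have "a \<in> carrier L" "b = \<zero>"
    by auto
  \<comment> \<open>\<alpha> inverts \<sigma>, so the twist put on a by the second component is
    undone in the \<eta>-term.\<close>
  moreover have "\<alpha> (v \<otimes> \<sigma> a) = \<alpha> v \<otimes> a" if "v \<in> carrier L" for v
    using that \<open>a \<in> carrier L\<close> by (simp add: assms)
  ultimately show "(a, b) \<in> right_nucleus alg"
    using \<eta> \<mu> by (simp add: right_nucleus_def assms l_distr r_distr m_ac)
qed

text \<open>The same two products, now multiplied by (a, b) on the left, give \<mu> b (\<sigma>(x) -
  \<gamma>(x)) = 0 and \<mu> b (\<sigma>(x) - \<gamma>(\<sigma>(x))) = 0. Both differences vanish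
  only if \<gamma>(x) = \<gamma>(\<sigma>(x)), that is, if \<sigma> fixes x.\<close>

lemma left_nucleus_alg:
  assumes "\<And>b. b \<in> carrier L \<Longrightarrow> \<beta> b = b" and "\<And>b. b \<in> carrier L \<Longrightarrow> \<delta> b = b"
  shows "left_nucleus alg = carrier L \<times> {\<zero>}"
proof (intro equalityI subrelI)
  fix a b
  assume ab: "(a, b) \<in> left_nucleus alg"
  then have [simp]: "a \<in> carrier L" "b \<in> carrier L"
    by (auto simp: left_nucleus_def)
  have assoc: "((a, b) \<otimes>\<^bsub>alg\<^esub> p) \<otimes>\<^bsub>alg\<^esub> q = (a, b) \<otimes>\<^bsub>alg\<^esub> (p \<otimes>\<^bsub>alg\<^esub> q)"
    if "p \<in> carrier alg" "q \<in> carrier alg" for p q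
    using ab that unfolding left_nucleus_def by blast
  obtain x where x [simp]: "x \<in> carrier L" and "\<sigma> x \<noteq> x"
    using nontrivial by blast
  then have "\<sigma> x \<noteq> \<gamma> x \<or> \<sigma> x \<noteq> \<gamma> (\<sigma> x)"
    by (metis twists_hom(1) twists_hom(4) hom_inj_iff ring_hom_closed)
  then have "\<mu> \<otimes> b = \<zero>"
  proof
    have "x \<otimes> a \<oplus> (\<mu> \<otimes> b) \<otimes> \<sigma> x = x \<otimes> a \<oplus> (\<mu> \<otimes> b) \<otimes> \<gamma> x"
      using assoc[of "(x, \<zero>)" "(\<zero>, \<one>)"] \<eta> \<mu> by (simp add: assms m_ac)
    moreover assume "\<sigma> x \<noteq> \<gamma> x"
    ultimately show ?thesis
      using distinct_multiples[of "\<mu> \<otimes> b" "\<sigma> x" "\<gamma> x" "x \<otimes> a"] \<mu> by simp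
  next
    have "\<sigma> x \<otimes> a \<oplus> (\<mu> \<otimes> b) \<otimes> \<sigma> x = \<sigma> x \<otimes> a \<oplus> (\<mu> \<otimes> b) \<otimes> \<gamma> (\<sigma> x)"
      using assoc[of "(\<zero>, \<one>)" "(x, \<zero>)"] \<eta> \<mu> by (simp add: assms r_distr l_distr m_ac)
    moreover assume "\<sigma> x \<noteq> \<gamma> (\<sigma> x)"
    ultimately show ?thesis
      using distinct_multiples[of "\<mu> \<otimes> b" "\<sigma> x" "\<gamma> (\<sigma> x)" "\<sigma> x \<otimes> a"] \<mu> by simp
  qed
  then show "(a, b) \<in> carrier L \<times> {\<zero>}"
    using \<mu> by (simp add: integral_iff)
next
  fix a b
  assume "(a, b) \<in> carrier L \<times> {\<zero>}"
  then show "(a, b) \<in> left_nucleus alg"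
    using \<eta> \<mu> by (auto simp add: left_nucleus_def assms l_distr r_distr m_ac)
qed

text \<open>Under either alternative of \<open>nuclear\<close> the first summand is a nucleus, and
  automorphisms map nuclei onto themselves.\<close>

lemma alg_Aut_first_summand:
  assumes "g \<in> carrier (alg_Aut F alg)"
  shows "g ` (carrier L \<times> {\<zero>}) = carrier L \<times> {\<zero>}"
  using nuclear right_nucleus_alg left_nucleus_alg alg_closed
    alg_Aut_right_nucleus[OF assms] alg_Aut_left_nucleus[OF assms] by metis

section \<open>Automorphisms as pairs of a field automorphism and a scalar\<close>

text \<open>The two equations are the components of the image of (0, 1)(0, 1) = (\<eta>, \<mu>)
  under (x, y) \<mapsto> (\<tau>(x), b \<tau>(y)), with a common factor b cancelled in the
  second.\<close>

definition compatible :: "('a \<Rightarrow> 'a) \<Rightarrow> 'a \<Rightarrow> bool" where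
  "compatible \<tau> b \<longleftrightarrow>
     \<tau> \<in> centraliser (field_Aut L F) \<sigma> \<and> b \<in> carrier L \<and> b \<noteq> \<zero> \<and>
     \<tau> \<eta> = \<eta> \<otimes> \<alpha> b \<otimes> \<beta> b \<and> \<tau> \<mu> = \<mu> \<otimes> \<gamma> (\<delta> b)"

definition lift :: "('a \<Rightarrow> 'a) \<Rightarrow> 'a \<Rightarrow> 'a \<times> 'a \<Rightarrow> 'a \<times> 'a" where
  "lift \<tau> b = (\<lambda>(x, y)\<in>carrier L \<times> carrier L. (\<tau> x, b \<otimes> \<tau> y))"

lemma lift_apply [simp]:
  "x \<in> carrier L \<Longrightarrow> y \<in> carrier L \<Longrightarrow> lift \<tau> b (x, y) = (\<tau> x, b \<otimes> \<tau> y)"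
  by (simp add: lift_def)

text \<open>One of \<gamma> and \<delta> is the identity in either case of \<open>nuclear\<close>.
  This is what allows the factor b to be split off the \<mu>-term.\<close>

lemma \<gamma>_mult_\<delta>: "b \<in> carrier L \<Longrightarrow> \<gamma> b \<otimes> \<delta> b = b \<otimes> \<gamma> (\<delta> b)"
  using nuclear by (auto simp: m_comm)

text \<open>Bijectivity is checked componentwise, b being a unit. Since \<tau> commutes with every
  twist, multiplicativity comes down to the effect of \<tau> on the coefficients \<eta> and
  \<mu>.\<close>

lemma lift_in_alg_Aut:
  assumes "compatible \<tau> b"
  shows "lift \<tau> b \<in> carrier (alg_Aut F alg)"
proof -
  have \<tau>: "\<tau> \<in> carrier (field_Aut L F)" and comm: "\<And>x. x \<in> carrier L \<Longrightarrow> \<tau> (\<sigma> x) = \<sigma> (\<tau> x)"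
    and b: "b \<in> carrier L" "b \<noteq> \<zero>"
    and \<tau>\<eta>: "\<tau> \<eta> = \<eta> \<otimes> \<alpha> b \<otimes> \<beta> b" and \<tau>\<mu>: "\<tau> \<mu> = \<mu> \<otimes> \<gamma> (\<delta> b)"
    using assms by (auto simp: compatible_def field_Aut_centraliser_iff[OF \<sigma>_Aut])
  have hom: "\<tau> \<in> ring_hom L L" and bij: "bij_betw \<tau> (carrier L) (carrier L)"
    and fixed: "\<And>a. a \<in> F \<Longrightarrow> \<tau> a = a"
    using \<tau> by (auto simp: field_Aut_iff)
  note [simp] = ring_hom_closed[OF hom] ring_hom_mult[OF hom] ring_hom_add[OF hom]
    ring_hom_one[OF hom] ring_hom_zero[OF hom ring_axioms ring_axioms] b(1) \<eta>(1) \<mu>(1)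
    twists[THEN twistsD(3), OF hom comm]
  have "inj_on (\<lambda>y. b \<otimes> \<tau> y) (carrier L)"
    using b by (auto intro!: inj_onI simp: m_lcancel hom_inj_iff[OF hom])
  moreover have "y \<in> (\<lambda>y. b \<otimes> \<tau> y) ` carrier L" if y: "y \<in> carrier L" for y
  proof -
    have inv: "inv b \<in> carrier L" "b \<otimes> inv b = \<one>"
      using b by (auto simp: field_Units)
    then obtain z where "z \<in> carrier L" "\<tau> z = inv b \<otimes> y"
      using bij y by (metis bij_betw_def image_iff m_closed)
    then show ?thesis
      using inv y b by (auto simp: m_assoc[symmetric] intro!: image_eqI[of _ _ z])
  qed
  ultimately have "bij_betw (\<lambda>y. b \<otimes> \<tau> y) (carrier L) (carrier L)"
    unfolding bij_betw_def by auto
  with bij have "bij_betw (map_prod \<tau> (\<lambda>y. b \<otimes> \<tau> y)) (carrier alg) (carrier alg)"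
    unfolding alg_simps by (rule bij_betw_map_prod)
  moreover have "bij_betw (map_prod \<tau> (\<lambda>y. b \<otimes> \<tau> y)) (carrier alg) (carrier alg) \<longleftrightarrow>
      bij_betw (lift \<tau> b) (carrier alg) (carrier alg)"
    by (rule bij_betw_cong) auto
  ultimately have "bij_betw (lift \<tau> b) (carrier alg) (carrier alg)"
    by blast
  moreover have "lift \<tau> b \<in> extensional (carrier alg)"
    by (simp add: lift_def)
  moreover have "lift \<tau> b (p \<otimes>\<^bsub>alg\<^esub> q) = lift \<tau> b p \<otimes>\<^bsub>alg\<^esub> lift \<tau> b q"
    if p: "p \<in> carrier alg" and q: "q \<in> carrier alg" for p q
  proof -
    obtain x y u v where pq: "p = (x, y)" "q = (u, v)"
      and [simp]: "x \<in> carrier L" "y \<in> carrier L" "u \<in> carrier L" "v \<in> carrier L"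
      using p q by auto
    \<comment> \<open>The \<mu>-term is treated by hand: b must be distributed over the arguments of
      both \<gamma> and \<delta>.\<close>
    have "b \<otimes> (\<mu> \<otimes> \<gamma> (\<delta> b) \<otimes> \<gamma> (\<tau> v) \<otimes> \<delta> (\<tau> y)) = \<mu> \<otimes> (b \<otimes> \<gamma> (\<delta> b)) \<otimes> \<gamma> (\<tau> v) \<otimes> \<delta> (\<tau> y)"
      by (simp add: m_ac)
    also have "\<dots> = \<mu> \<otimes> \<gamma> (b \<otimes> \<tau> v) \<otimes> \<delta> (b \<otimes> \<tau> y)"
      by (simp add: \<gamma>_mult_\<delta>[symmetric] m_ac)
    finally show ?thesis
      by (simp add: pq \<tau>\<eta> \<tau>\<mu> r_distr) (simp add: m_ac)
  qed
  moreover have "lift \<tau> b p \<in> carrier alg"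
    "lift \<tau> b (p \<oplus>\<^bsub>alg\<^esub> q) = lift \<tau> b p \<oplus>\<^bsub>alg\<^esub> lift \<tau> b q"
    "\<And>a. a \<in> F \<Longrightarrow> lift \<tau> b (a \<odot>\<^bsub>alg\<^esub> p) = a \<odot>\<^bsub>alg\<^esub> lift \<tau> b p"
    if "p \<in> carrier alg" "q \<in> carrier alg" for p q
    using that fixed F_subset by (auto simp: r_distr m_lcomm subset_iff)
  moreover have "lift \<tau> b \<one>\<^bsub>alg\<^esub> = \<one>\<^bsub>alg\<^esub>"
    by simp
  ultimately show ?thesis
    by (auto simp: alg_Aut_iff intro!: ring_hom_memI)
qed


lemma alg_Aut_eq_lift:
  assumes g: "g \<in> carrier (alg_Aut F alg)"
  obtains \<tau> b where "compatible \<tau> b" "g = lift \<tau> b"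
proof -
  have ext: "g \<in> extensional (carrier L \<times> carrier L)"
    and bij: "bij_betw g (carrier L \<times> carrier L) (carrier L \<times> carrier L)"
    and hom: "g \<in> ring_hom alg alg"
    and smult: "\<And>a p. a \<in> F \<Longrightarrow> p \<in> carrier alg \<Longrightarrow> g (a \<odot>\<^bsub>alg\<^esub> p) = a \<odot>\<^bsub>alg\<^esub> g p"
    using g by (auto simp: alg_Aut_iff)
  have g_mult: "g (p \<otimes>\<^bsub>alg\<^esub> q) = g p \<otimes>\<^bsub>alg\<^esub> g q" and g_add: "g (p \<oplus>\<^bsub>alg\<^esub> q) = g p \<oplus>\<^bsub>alg\<^esub> g q"
    if "p \<in> carrier alg" "q \<in> carrier alg" for p q
    using hom that by (auto simp: ring_hom_mult ring_hom_add)
  have g_one: "g (\<one>, \<zero>) = (\<one>, \<zero>)"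
    using ring_hom_one[OF hom] by simp
  note [simp] = \<eta>(1) \<mu>(1)
  define \<tau> where "\<tau> = (\<lambda>x\<in>carrier L. fst (g (x, \<zero>)))"
  have image: "g ` (carrier L \<times> {\<zero>}) = carrier L \<times> {\<zero>}"
    using g by (rule alg_Aut_first_summand)
  have g_fst: "g (x, \<zero>) = (\<tau> x, \<zero>)" and \<tau>_closed [simp]: "\<tau> x \<in> carrier L"
    if "x \<in> carrier L" for x
  proof -
    have "g (x, \<zero>) \<in> carrier L \<times> {\<zero>}"
      using image that by blast
    then show "g (x, \<zero>) = (\<tau> x, \<zero>)" "\<tau> x \<in> carrier L"
      using that by (auto simp: \<tau>_def)
  qed
  have \<tau>_hom: "\<tau> \<in> ring_hom L L"
  proof (rule ring_hom_memI)
    fix x y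
    assume [simp]: "x \<in> carrier L" "y \<in> carrier L"
    show "\<tau> (x \<otimes> y) = \<tau> x \<otimes> \<tau> y" "\<tau> (x \<oplus> y) = \<tau> x \<oplus> \<tau> y"
      using g_mult[of "(x, \<zero>)" "(y, \<zero>)"] g_add[of "(x, \<zero>)" "(y, \<zero>)"] by (simp_all add: g_fst)
  qed (use g_one g_fst in auto)
  note [simp] = ring_hom_mult[OF \<tau>_hom] ring_hom_add[OF \<tau>_hom] ring_hom_one[OF \<tau>_hom]
    ring_hom_zero[OF \<tau>_hom ring_axioms ring_axioms] hom_inj_iff[OF \<tau>_hom]
  have "\<tau> ` carrier L = carrier L"
  proof (intro equalityI subsetI)
    fix z assume "z \<in> carrier L"
    then have "(z, \<zero>) \<in> g ` (carrier L \<times> {\<zero>})"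
      using image by simp
    then show "z \<in> \<tau> ` carrier L"
      using g_fst by force
  qed auto
  moreover have "inj_on \<tau> (carrier L)"
    by (simp add: inj_on_def)
  \<comment> \<open>F-linearity is applied to (a, 0) = a (1, 0).\<close>
  moreover have "\<tau> a = a" if "a \<in> F" for a
    using smult[OF that, of "(\<one>, \<zero>)"] that F_subset g_fst[of a] by (auto simp: g_one)
  ultimately have \<tau>_Aut: "\<tau> \<in> carrier (field_Aut L F)"
    using \<tau>_hom by (simp add: field_Aut_iff bij_betw_def \<tau>_def)

  obtain a b where ab: "g (\<zero>, \<one>) = (a, b)" and [simp]: "a \<in> carrier L" "b \<in> carrier L"
    using ring_hom_closed[OF hom, of "(\<zero>, \<one>)"] by auto
  \<comment> \<open>(0, y) = (y, 0)(0, 1), so g is determined by \<tau> and the image of (0,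
    1).\<close>
  have g_snd: "g (\<zero>, y) = (\<tau> y \<otimes> a, b \<otimes> \<tau> y)" if [simp]: "y \<in> carrier L" for y
    using g_mult[of "(y, \<zero>)" "(\<zero>, \<one>)"] by (simp add: g_fst ab)
  \<comment> \<open>These are the two components of g applied to (0, 1)(u, 0) = (0,
    \<sigma>(u)).\<close>
  have semilinear: "\<tau> (\<sigma> u) \<otimes> a = a \<otimes> \<tau> u" "b \<otimes> \<tau> (\<sigma> u) = b \<otimes> \<sigma> (\<tau> u)"
    if [simp]: "u \<in> carrier L" for u
    using g_mult[of "(\<zero>, \<one>)" "(u, \<zero>)"] by (simp_all add: g_fst g_snd)
  obtain x where x: "x \<in> carrier L" "\<sigma> x \<noteq> x"
    using nontrivial by blast
  \<comment> \<open>Cancelling a nonzero a would give \<tau>(\<sigma>(x)) = \<tau>(x), although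
    \<sigma> moves x and \<tau> is injective.\<close>
  have a: "a = \<zero>"
    using semilinear(1)[of x] x m_lcancel[of a "\<tau> (\<sigma> x)" "\<tau> x"] by (auto simp: m_comm[of _ a])
  have "g (\<zero>, \<one>) \<noteq> g (\<zero>, \<zero>)"
    using inj_on_eq_iff[OF bij_betw_imp_inj_on[OF bij], of "(\<zero>, \<one>)" "(\<zero>, \<zero>)"] by simp
  then have b: "b \<noteq> \<zero>"
    by (simp add: g_snd a)
  have comm: "\<tau> (\<sigma> u) = \<sigma> (\<tau> u)" if "u \<in> carrier L" for u
    using semilinear(2)[OF that] that b by (simp add: m_lcancel)
  have g_eq: "g (x, y) = (\<tau> x, b \<otimes> \<tau> y)" if [simp]: "x \<in> carrier L" "y \<in> carrier L" for x y
    using g_add[of "(x, \<zero>)" "(\<zero>, y)"] by (simp add: g_fst g_snd a)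
  \<comment> \<open>Both equations come from squaring (0, 1), whose image is now (0, b).\<close>
  have "\<tau> \<eta> = \<eta> \<otimes> \<alpha> b \<otimes> \<beta> b" and "b \<otimes> \<tau> \<mu> = \<mu> \<otimes> \<gamma> b \<otimes> \<delta> b"
    using g_mult[of "(\<zero>, \<one>)" "(\<zero>, \<one>)"] by (simp_all add: g_eq)
  moreover from this(2) have "b \<otimes> \<tau> \<mu> = b \<otimes> (\<mu> \<otimes> \<gamma> (\<delta> b))"
    by (simp add: m_assoc \<gamma>_mult_\<delta> m_lcomm)
  then have "\<tau> \<mu> = \<mu> \<otimes> \<gamma> (\<delta> b)"
    using b by (simp add: m_lcancel)
  ultimately have "compatible \<tau> b"
    using b \<tau>_Aut comm by (simp add: compatible_def field_Aut_centraliser_iff[OF \<sigma>_Aut])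
  moreover have "g = lift \<tau> b"
    using ext by (intro extensionalityI[of _ "carrier L \<times> carrier L"]) (auto simp: lift_def g_eq)
  ultimately show thesis
    by (rule that)
qed

section \<open>Eliminating the scalar\<close>

text \<open>Let r = \<mu> \<sigma>(\<mu>) / \<sigma>(\<eta>). The hypothesis on \<tau>(\<mu>) says
  how \<tau> scales r \<sigma>(\<eta>) = \<mu> \<sigma>(\<mu>): by the factor d, which
  \<open>norm\<close> identifies with \<sigma>(\<alpha>(b) \<beta>(b)). Hence \<tau> fixes r iff it
  scales \<sigma>(\<eta>) by d, and injectivity of \<sigma> turns this into the condition on
  \<eta>.\<close>

lemma compatible_\<eta>_iff:
  assumes \<tau>: "\<tau> \<in> centraliser (field_Aut L F) \<sigma>" and b: "b \<in> carrier L" "b \<noteq> \<zero>"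
    and \<tau>\<mu>: "\<tau> \<mu> = \<mu> \<otimes> \<gamma> (\<delta> b)"
  shows "\<tau> \<eta> = \<eta> \<otimes> \<alpha> b \<otimes> \<beta> b \<longleftrightarrow>
    \<tau> (\<mu> \<otimes> \<sigma> \<mu> \<otimes> inv (\<sigma> \<eta>)) = \<mu> \<otimes> \<sigma> \<mu> \<otimes> inv (\<sigma> \<eta>)"
proof -
  have hom: "\<tau> \<in> ring_hom L L" and comm: "\<And>x. x \<in> carrier L \<Longrightarrow> \<tau> (\<sigma> x) = \<sigma> (\<tau> x)"
    using \<tau> by (auto simp: field_Aut_centraliser_iff[OF \<sigma>_Aut] field_Aut_iff)
  note [simp] = b(1) \<eta>(1) \<mu>(1) ring_hom_closed[OF hom]
  define r where "r = \<mu> \<otimes> \<sigma> \<mu> \<otimes> inv (\<sigma> \<eta>)"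
  define d where "d = \<gamma> (\<delta> b) \<otimes> \<sigma> (\<gamma> (\<delta> b))"
  have inv: "inv (\<sigma> \<eta>) \<in> carrier L" "inv (\<sigma> \<eta>) \<otimes> \<sigma> \<eta> = \<one>"
    using \<eta> by (auto simp: field_Units)
  have [simp]: "r \<in> carrier L" "d \<in> carrier L"
    using inv by (auto simp: r_def d_def)
  have r\<sigma>\<eta>: "r \<otimes> \<sigma> \<eta> = \<mu> \<otimes> \<sigma> \<mu>"
    using inv by (simp add: r_def m_assoc)
  have "\<mu> \<otimes> \<sigma> \<mu> \<noteq> \<zero>"
    using \<mu> by (simp add: integral_iff)
  then have "r \<noteq> \<zero>"
    using r\<sigma>\<eta> by auto
  have "\<sigma> \<eta> \<otimes> d \<noteq> \<zero>"
    using b \<eta> by (simp add: d_def integral_iff)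
  have "\<tau> r \<otimes> \<tau> (\<sigma> \<eta>) = \<tau> (r \<otimes> \<sigma> \<eta>)"
    by (simp add: ring_hom_mult[OF hom])
  also have "\<dots> = r \<otimes> \<sigma> \<eta> \<otimes> d"
    by (simp add: r\<sigma>\<eta> d_def ring_hom_mult[OF hom] comm \<tau>\<mu> m_ac)
  finally have \<tau>r: "\<tau> r \<otimes> \<tau> (\<sigma> \<eta>) = r \<otimes> (\<sigma> \<eta> \<otimes> d)"
    by (simp add: m_assoc)
  \<comment> \<open>\<open>twists_simps(6)\<close> is multiplicativity of \<sigma>; it is switched
    off so that \<sigma> stays outermost on both sides and can be cancelled.\<close>
  have "\<tau> \<eta> = \<eta> \<otimes> \<alpha> b \<otimes> \<beta> b \<longleftrightarrow> \<tau> (\<sigma> \<eta>) = \<sigma> (\<eta> \<otimes> (\<alpha> b \<otimes> \<beta> b))"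
    by (simp add: comm m_assoc del: twists_simps(6))
  also have "\<sigma> (\<eta> \<otimes> (\<alpha> b \<otimes> \<beta> b)) = \<sigma> \<eta> \<otimes> d"
    using norm[of b] by (simp add: d_def)
  also have "\<tau> (\<sigma> \<eta>) = \<sigma> \<eta> \<otimes> d \<longleftrightarrow> \<tau> r = r"
  proof
    assume "\<tau> (\<sigma> \<eta>) = \<sigma> \<eta> \<otimes> d"
    then show "\<tau> r = r"
      using \<tau>r \<open>\<sigma> \<eta> \<otimes> d \<noteq> \<zero>\<close> by (simp add: m_rcancel)
  next
    assume "\<tau> r = r"
    then show "\<tau> (\<sigma> \<eta>) = \<sigma> \<eta> \<otimes> d"
      using \<tau>r \<open>r \<noteq> \<zero>\<close> by (simp add: m_lcancel)
  qed
  finally show ?thesis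
    by (simp add: r_def)
qed

text \<open>The scalar is a solution of \<gamma>(\<delta>(b)) = \<tau>(\<mu>) / \<mu>, which exists
  because the composite of two twists is surjective. The equation for \<eta> then follows from the
  fixed element.\<close>

lemma compatible_exists:
  assumes \<tau>: "\<tau> \<in> centraliser (field_Aut L F) \<sigma>"
    and stable: "\<tau> (\<mu> \<otimes> \<sigma> \<mu> \<otimes> inv (\<sigma> \<eta>)) = \<mu> \<otimes> \<sigma> \<mu> \<otimes> inv (\<sigma> \<eta>)"
  obtains b where "compatible \<tau> b"
proof -
  have hom: "\<tau> \<in> ring_hom L L"
    using \<tau> by (auto simp: field_Aut_centraliser_iff[OF \<sigma>_Aut] field_Aut_iff)
  have \<tau>\<mu>: "\<tau> \<mu> \<in> carrier L" "\<tau> \<mu> \<noteq> \<zero>"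
    using \<mu> hom_inj_iff[OF hom, of \<mu> \<zero>] hom
    by (auto simp: ring_hom_closed ring_hom_zero[OF hom ring_axioms ring_axioms])
  have inv: "inv \<mu> \<in> carrier L" "\<mu> \<otimes> inv \<mu> = \<one>"
    using \<mu> by (auto simp: field_Units)
  have "(\<lambda>b. \<gamma> (\<delta> b)) ` carrier L = carrier L"
    using twists_comp[OF twists(4,5)] by (rule twistsD(2))
  then obtain b where b: "b \<in> carrier L" "\<gamma> (\<delta> b) = inv \<mu> \<otimes> \<tau> \<mu>"
    using inv \<tau>\<mu> by (metis (no_types, lifting) image_iff m_closed)
  then have eq: "\<tau> \<mu> = \<mu> \<otimes> \<gamma> (\<delta> b)"
    using inv \<tau>\<mu> \<mu> by (simp add: m_assoc[symmetric])
  then have "b \<noteq> \<zero>"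
    using \<tau>\<mu> \<mu> by auto
  then have "compatible \<tau> b"
    using compatible_\<eta>_iff[OF \<tau> b(1) _ eq] \<tau> b(1) eq stable by (simp add: compatible_def)
  then show thesis
    by (rule that)
qed

section \<open>The isomorphism for the common shape\<close>

theorem alg_Aut_iso:
  "alg_Aut F alg \<cong>
    (field_Aut L F)\<lparr>carrier := {\<tau> \<in> centraliser (field_Aut L F) \<sigma>.
        \<tau> (\<mu> \<otimes> \<sigma> \<mu> \<otimes> inv (\<sigma> \<eta>)) = \<mu> \<otimes> \<sigma> \<mu> \<otimes> inv (\<sigma> \<eta>)}\<rparr>" (is "_ \<cong> ?S")
proof -
  \<comment> \<open>\<Phi> restricts an automorphism to the first summand, cut down to an
    extensional map as the elements of \<open>field_Aut\<close> are.\<close>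
  define \<Phi> where "\<Phi> g = (\<lambda>x\<in>carrier L. fst (g (x, \<zero>)))" for g :: "'a \<times> 'a \<Rightarrow> 'a \<times> 'a"
  have Aut: "\<tau> \<in> carrier (field_Aut L F)" if "compatible \<tau> b" for \<tau> b
    using that by (simp add: compatible_def centraliser_def)
  have \<Phi>_lift: "\<Phi> (lift \<tau> b) = \<tau>" if "compatible \<tau> b" for \<tau> b
    using Aut[OF that]
    by (intro extensionalityI[of _ "carrier L"]) (auto simp: \<Phi>_def field_Aut_iff)
  have "\<Phi> \<in> iso (alg_Aut F alg) ?S"
    unfolding iso_iff
  proof (intro conjI homI)
    fix g assume "g \<in> carrier (alg_Aut F alg)"
    then obtain \<tau> b where g: "compatible \<tau> b" "g = lift \<tau> b"
      by (rule alg_Aut_eq_lift)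
    then show "\<Phi> g \<in> carrier ?S"
      using compatible_\<eta>_iff by (auto simp: \<Phi>_lift compatible_def)
  next
    fix g h
    assume gh: "g \<in> carrier (alg_Aut F alg)" "h \<in> carrier (alg_Aut F alg)"
    obtain \<tau> b where g: "compatible \<tau> b" "g = lift \<tau> b"
      using gh(1) by (rule alg_Aut_eq_lift)
    obtain \<rho> c where h: "compatible \<rho> c" "h = lift \<rho> c"
      using gh(2) by (rule alg_Aut_eq_lift)
    have hom: "\<tau> \<in> ring_hom L L" "\<rho> \<in> ring_hom L L"
      using Aut[OF g(1)] Aut[OF h(1)] by (auto simp: field_Aut_iff)
    have c: "c \<in> carrier L"
      using h(1) by (simp add: compatible_def)
    have "\<Phi> (g \<otimes>\<^bsub>alg_Aut F alg\<^esub> h) = \<Phi> (compose (carrier alg) g h)"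
      using gh by (simp add: alg_Aut_mult)
    also have "\<dots> = compose (carrier L) \<tau> \<rho>"
      using hom c by (intro ext)
        (simp add: \<Phi>_def compose_def g(2) h(2) ring_hom_closed
          ring_hom_zero[OF _ ring_axioms ring_axioms])
    also have "\<dots> = \<Phi> g \<otimes>\<^bsub>field_Aut L F\<^esub> \<Phi> h"
      using Aut[OF g(1)] Aut[OF h(1)] g h by (simp add: field_Aut_mult \<Phi>_lift)
    finally show "\<Phi> (g \<otimes>\<^bsub>alg_Aut F alg\<^esub> h) = \<Phi> g \<otimes>\<^bsub>?S\<^esub> \<Phi> h"
      by simp
  next
    show "\<Phi> ` carrier (alg_Aut F alg) = carrier ?S"
    proof (intro equalityI subsetI)
      fix \<tau> assume "\<tau> \<in> \<Phi> ` carrier (alg_Aut F alg)"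
      then obtain g where g: "g \<in> carrier (alg_Aut F alg)" "\<tau> = \<Phi> g"
        by blast
      obtain \<rho> b where "compatible \<rho> b" "g = lift \<rho> b"
        using g(1) by (rule alg_Aut_eq_lift)
      then show "\<tau> \<in> carrier ?S"
        using g(2) compatible_\<eta>_iff by (auto simp: \<Phi>_lift compatible_def)
    next
      fix \<tau> assume "\<tau> \<in> carrier ?S"
      then obtain b where "compatible \<tau> b"
        using compatible_exists by auto
      then show "\<tau> \<in> \<Phi> ` carrier (alg_Aut F alg)"
        using lift_in_alg_Aut \<Phi>_lift by (metis image_eqI)
    qed
  next
    show "inj_on \<Phi> (carrier (alg_Aut F alg))"
    proof (rule inj_onI)
      fix g h
      assume gh: "g \<in> carrier (alg_Aut F alg)" "h \<in> carrier (alg_Aut F alg)" "\<Phi> g = \<Phi> h"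
      obtain \<tau> b where g: "compatible \<tau> b" "g = lift \<tau> b"
        using gh(1) by (rule alg_Aut_eq_lift)
      obtain \<rho> c where h: "compatible \<rho> c" "h = lift \<rho> c"
        using gh(2) by (rule alg_Aut_eq_lift)
      have "\<tau> = \<rho>"
        using gh(3) g h by (simp add: \<Phi>_lift)
      \<comment> \<open>Both scalars satisfy the equation for \<tau>(\<mu>), and \<mu> is nonzero
        while \<gamma> and \<delta> are injective.\<close>
      moreover from this have "b = c"
        using g(1) h(1) \<mu> by (auto simp: compatible_def m_lcancel)
      ultimately show "g = h"
        using g(2) h(2) by simp
    qed
  qed
  then show ?thesis
    by (rule is_isoI)
qed

end

section \<open>Specialisation to the three algebras\<close>

theorem proposition6p5:
  fixes L :: "('a, 'm) ring_scheme" (structure)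
    and F :: "'a set" and \<sigma> :: "'a \<Rightarrow> 'a" and \<eta> \<mu> :: 'a
    and A :: "('a, 'a \<times> 'a) module"
  assumes "separable_extension F L"
    and "\<sigma> \<in> carrier (field_Aut L F)" and "\<sigma> \<noteq> \<one>\<^bsub>field_Aut L F\<^esub>"
    and "\<eta> \<in> carrier L" and "\<mu> \<in> carrier L" and "\<eta> \<noteq> \<zero>" and "\<mu> \<noteq> \<zero>"
    and "A \<in> {HK L \<sigma> \<eta> \<mu>, Kn2 L \<sigma> \<eta> \<mu>, Kn3 L \<sigma> \<eta> \<mu>}"
  shows "alg_Aut F A \<cong>
    (field_Aut L F)\<lparr>carrier := {\<tau> \<in> centraliser (field_Aut L F) \<sigma>.
        \<tau> (\<mu> \<otimes> \<sigma> \<mu> \<otimes> inv (\<sigma> \<eta>)) = \<mu> \<otimes> \<sigma> \<mu> \<otimes> inv (\<sigma> \<eta>)}\<rparr>"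
proof -
  define \<sigma>' where "\<sigma>' = inv_into (carrier L) \<sigma>"
  interpret field L
    using assms(1) by (simp add: separable_extension_def)
  have F: "F \<subseteq> carrier L"
    using assms(1) subfieldE(3) by (auto simp: separable_extension_def)
  have \<sigma>: "\<sigma> \<in> ring_hom L L" "bij_betw \<sigma> (carrier L) (carrier L)" "\<sigma> \<in> extensional (carrier L)"
    using assms(2) by (auto simp: field_Aut_iff)
  \<comment> \<open>The unit of the group is the identity restricted to the carrier, so
    extensionality of \<sigma> yields a moved point inside L.\<close>
  have nontrivial: "\<exists>x\<in>carrier L. \<sigma> x \<noteq> x"
    using assms(3) \<sigma>(3) extensionalityI[of \<sigma> "carrier L" "\<lambda>x\<in>carrier L. x"]
    by (auto simp: field_Aut_def BijGroup_def)
  have tw: "\<sigma> \<in> twists L \<sigma>" "\<sigma>' \<in> twists L \<sigma>"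
    using \<sigma> ring_axioms by (auto simp: \<sigma>'_def bij_betw_def intro: twists_self twists_inv)
  have \<sigma>'_closed [simp]: "\<sigma>' x \<in> carrier L" and inv1 [simp]: "\<sigma> (\<sigma>' x) = x" and inv2 [simp]: "\<sigma>' (\<sigma> x) = x"
    and \<sigma>_closed [simp]: "\<sigma> x \<in> carrier L" if "x \<in> carrier L" for x
    using that \<sigma> tw by (auto simp: \<sigma>'_def bij_betw_inv_into_left bij_betw_inv_into_right
        ring_hom_closed inv_into_into bij_betw_def)
  note \<sigma>_mult = ring_hom_mult[OF \<sigma>(1)]
  note facts = assms(2,4-7) F tw nontrivial twists_id twists_comp[OF tw(2,2)]
  \<comment> \<open>Both sides of \<open>norm\<close> become \<sigma>(b) \<sigma>(\<sigma>(b)) for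
    \<open>HK\<close>, b \<sigma>'(b) for \<open>Kn2\<close> and b \<sigma>(b) for
    \<open>Kn3\<close>. The second disjunct of \<open>nuclear\<close> holds for \<open>HK\<close>,
    the first for \<open>Kn2\<close>, and both for \<open>Kn3\<close>.\<close>
  have HK: "twisted_double L F \<sigma> \<sigma> (\<lambda>x. x) \<sigma> (\<lambda>x. x) \<eta> \<mu>"
    using facts by unfold_locales (auto simp: \<sigma>_mult m_comm)
  have Kn2: "twisted_double L F \<sigma> \<sigma>' (\<lambda>x. \<sigma>' (\<sigma>' x)) (\<lambda>x. x) \<sigma>' \<eta> \<mu>"
    using facts by unfold_locales (auto simp: \<sigma>_mult m_comm)
  have Kn3: "twisted_double L F \<sigma> \<sigma>' (\<lambda>x. x) (\<lambda>x. x) (\<lambda>x. x) \<eta> \<mu>"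
    using facts by unfold_locales (auto simp: \<sigma>_mult)
  show ?thesis
    using assms(8) HK[THEN twisted_double.alg_Aut_iso] Kn2[THEN twisted_double.alg_Aut_iso]
      Kn3[THEN twisted_double.alg_Aut_iso]
    unfolding HK[THEN twisted_double.alg_def] Kn2[THEN twisted_double.alg_def]
      Kn3[THEN twisted_double.alg_def]
    by (auto simp: HK_def Kn2_def Kn3_def \<sigma>'_def[symmetric])
qed

end
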